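(* Let $t \ge 1$ be an integer and let $G$ be a finite graph (loops and multiple edges allowed) which does not contain an immersion of the complete graph $K_t$. Then there exists a laminar family of edge-cuts of $G$, each of size $< (t-1)^2$, such that every block of the resulting partition of $V(G)$ has size less than $t$.
   Context: All graphs are finite and may have loops and multiple edges. $K_t$ denotes the (simple) complete graph on $t$ vertices. Immersion: a graph $H$ is immersed in a graph $G$ (equivalently, $G$ contains an immersion of $H$) if there is an injective function $\phi: V(H)\to V(G)$ and, for each edge $uv\in E(H)$, a path $P_{uv}$ in $G$ joining $\phi(u)$ and $\phi(v)$, such that the paths $P_{uv}$, $uv\in E(H)$, are pairwise edge-disjoint. Edge-cuts: for $X\subseteq V(G)$, $\delta(X)$ denotes the edge-cut of $G$ consisting of all edges between $X$ and $V(G)\setminus X$; its size is the number of these edges, counted with multiplicity. An edge-cut is regarded together with its associated vertex partition $\{X, V(G)\setminus X\}$ (this matters when $G$ is disconnected, where the edge set $\delta(X)$ does not determine the partition). The edge-cut $\delta(X)$ separates $x,y\in V(G)$ if exactly one of $x,y$ lies in $X$. Laminar families: two edge-cuts $\delta(X)$ and $\delta(Y)$ in a connected graph $G$ are uncrossed if either $X$ or $V(G)\setminus X$ is contained in either $Y$ or $V(G)\setminus Y$. In a general graph, two edge-cuts are uncrossed if this holds in each component, i.e. for every component $C$ of $G$, one of $X\cap V(C)$, $V(C)\setminus X$ is contained in one of $Y\cap V(C)$, $V(C)\setminus Y$. A family of pairwise uncrossed edge-cuts is called laminar. Resulting partition: a family of edge-cuts of $G$ yields a partition of $V(G)$ in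 which two vertices lie in the same block if and only if no edge-cut of the family separates them. The size of a block is its number of vertices. *)

theory Defs
  imports Main "HOL-Library.Disjoint_Sets"
begin

text \<open>
  Undirected graphs with loops and multiple edges. The ends of an edge form a set of
  vertices, which is a singleton exactly if the edge is a loop.
\<close>

record ('v, 'e) multigraph =
  verts :: "'v set"
  edges :: "'e set"
  ends :: "'e \<Rightarrow> 'v set"

locale finite_multigraph =
  fixes G :: "('v, 'e) multigraph"
  assumes finite_verts: "finite (verts G)"
    and finite_edges: "finite (edges G)"
    and ends_subset: "e \<in> edges G \<Longrightarrow> ends G e \<subseteq> verts G"
    and card_ends: "e \<in> edges G \<Longrightarrow> card (ends G e) \<in> {1, 2}"

definition complete_graph :: "nat \<Rightarrow> (nat, nat set) multigraph" where
  "complete_graph t =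
     \<lparr>verts = {..<t}, edges = {e. e \<subseteq> {..<t} \<and> card e = 2}, ends = (\<lambda>e. e)\<rparr>"

lemma finite_multigraph_complete_graph: "finite_multigraph (complete_graph t)"
  by unfold_locales (auto simp: complete_graph_def intro: finite_subset[of _ "Pow {..<t}"])

definition is_path :: "('v, 'e) multigraph \<Rightarrow> 'v list \<Rightarrow> 'e list \<Rightarrow> bool" where
  "is_path G vs es \<longleftrightarrow>
     length vs = Suc (length es) \<and> distinct vs \<and> set vs \<subseteq> verts G \<and> set es \<subseteq> edges G \<and>
     (\<forall>i < length es. ends G (es ! i) = {vs ! i, vs ! Suc i})"

text \<open>
  The edge \<open>e\<close> of \<open>H\<close> is mapped to the path with vertex sequence \<open>W e\<close> and edge sequence
  \<open>P e\<close>. Its end vertices are compared as a set with the images of the ends of \<open>e\<close>, so no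
  orientation of \<open>e\<close> is chosen. If \<open>H\<close> has a loop, the path assigned to it is a single vertex.
\<close>

definition immersed :: "('w, 'f) multigraph \<Rightarrow> ('v, 'e) multigraph \<Rightarrow> bool" where
  "immersed H G \<longleftrightarrow>
     (\<exists>\<phi> W P. inj_on \<phi> (verts H) \<and> \<phi> ` verts H \<subseteq> verts G \<and>
        (\<forall>e \<in> edges H. is_path G (W e) (P e) \<and> {hd (W e), last (W e)} = \<phi> ` ends H e) \<and>
        disjoint_family_on (\<lambda>e. set (P e)) (edges H))"

definition adjacency :: "('v, 'e) multigraph \<Rightarrow> ('v \<times> 'v) set" where
  "adjacency G = {(u, v). \<exists>e \<in> edges G. ends G e = {u, v}}"

definition components :: "('v, 'e) multigraph \<Rightarrow> 'v set set" where
  "components G = {{v \<in> verts G. (u, v) \<in> (adjacency G)\<^sup>*} | u. u \<in> verts G}"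

text \<open>
  An edge-cut is considered together with its vertex partition \<open>{X, verts G - X}\<close>, and is
  represented by either of the two sides \<open>X \<subseteq> verts G\<close>. Every notion below is unchanged
  when \<open>X\<close> is replaced by \<open>verts G - X\<close>.
\<close>

definition cut_edges :: "('v, 'e) multigraph \<Rightarrow> 'v set \<Rightarrow> 'e set" where
  "cut_edges G X = {e \<in> edges G. \<exists>x \<in> X. \<exists>y \<in> verts G - X. ends G e = {x, y}}"

definition separates :: "'v set \<Rightarrow> 'v \<Rightarrow> 'v \<Rightarrow> bool" where
  "separates X x y \<longleftrightarrow> (x \<in> X) \<noteq> (y \<in> X)"

definition uncrossed :: "('v, 'e) multigraph \<Rightarrow> 'v set \<Rightarrow> 'v set \<Rightarrow> bool" where
  "uncrossed G X Y \<longleftrightarrow>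
     (\<forall>C \<in> components G. \<exists>A \<in> {X \<inter> C, C - X}. \<exists>B \<in> {Y \<inter> C, C - Y}. A \<subseteq> B)"

definition laminar :: "('v, 'e) multigraph \<Rightarrow> 'v set set \<Rightarrow> bool" where
  "laminar G \<F> \<longleftrightarrow> (\<forall>X \<in> \<F>. \<forall>Y \<in> \<F>. uncrossed G X Y)"

definition unseparated :: "('v, 'e) multigraph \<Rightarrow> 'v set set \<Rightarrow> ('v \<times> 'v) set" where
  "unseparated G \<F> =
     {(x, y). x \<in> verts G \<and> y \<in> verts G \<and> (\<forall>X \<in> \<F>. \<not> separates X x y)}"

definition blocks :: "('v, 'e) multigraph \<Rightarrow> 'v set set \<Rightarrow> 'v set set" where
  "blocks G \<F> = verts G // unseparated G \<F>"

end

theory Submission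
  imports Defs
begin

text \<open>
  Put \<open>k = (t - 1)\<^sup>2\<close>. Uncrossing minimum cuts, as for a Gomory-Hu tree, gives a laminar family of
  cuts of size less than \<open>k\<close> that separates any two vertices separated by some cut of size less
  than \<open>k\<close>. If a block contains \<open>t\<close> vertices \<open>v\<^sub>0, \<dots>, v\<^bsub>t-1\<^esub>\<close>, every cut between two of them has
  at least \<open>k\<close> edges, so by Menger's theorem there are \<open>k\<close> edge-disjoint paths from \<open>v\<^sub>0\<close>,
  of which \<open>t - 1\<close> end in each \<open>v\<^sub>i\<close> with \<open>i > 0\<close>. Call these \<open>P\<^sub>i\<^sub>j\<close> with \<open>0 < j < t\<close>. The edge
  \<open>0i\<close> of the complete graph is mapped to \<open>P\<^sub>i\<^sub>i\<close>, and the edge \<open>ij\<close> to a path in the union of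
  \<open>P\<^sub>i\<^sub>j\<close> and \<open>P\<^sub>j\<^sub>i\<close>.
\<close>

subsection \<open>Uncrossing for symmetric submodular functions\<close>

text \<open>The four corners are taken in all of \<open>V\<close>, not within a component, so the
  absence of crossing is stronger than \<open>uncrossed\<close> and needs no graph.\<close>

definition crossing :: "'a set \<Rightarrow> 'a set \<Rightarrow> 'a set \<Rightarrow> bool" where
  "crossing V X Y \<longleftrightarrow> X \<inter> Y \<noteq> {} \<and> X - Y \<noteq> {} \<and> Y - X \<noteq> {} \<and> V - (X \<union> Y) \<noteq> {}"

lemma crossing_commute: "crossing V X Y \<longleftrightarrow> crossing V Y X"
  by (auto simp: crossing_def)

text \<open>Complementing \<open>Y\<close> only permutes the four corners.\<close>

lemma crossing_Diff:
  assumes "X \<subseteq> V" "Y \<subseteq> V"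
  shows "crossing V X (V - Y) \<longleftrightarrow> crossing V X Y"
proof -
  have "X \<inter> (V - Y) = X - Y" "X - (V - Y) = X \<inter> Y" "V - Y - X = V - (X \<union> Y)"
    "V - (X \<union> (V - Y)) = Y - X"
    using assms by auto
  then show ?thesis
    unfolding crossing_def by metis
qed

lemma not_crossing_uncrossed_pair:
  assumes "X' \<in> {X \<union> Y, X - Y}"
  shows "\<not> crossing V X' Y"
  using assms by (auto simp: crossing_def)

text \<open>If \<open>Z\<close> crossed the union, it would have points outside \<open>X\<close> and
  outside \<open>Y\<close>, and cover \<open>V\<close> with neither. So each of \<open>X\<close>,
  \<open>Y\<close> would lie inside \<open>Z\<close> or be disjoint from it. As they intersect, the
  same alternative would hold for both and hence for the union, a contradiction.\<close>

lemma not_crossing_Un: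
  assumes "crossing V X Y" "\<not> crossing V X Z" "\<not> crossing V Y Z"
  shows "\<not> crossing V (X \<union> Y) Z"
  using assms unfolding crossing_def by blast

text \<open>The complement of \<open>X - Y\<close> is \<open>(V - X) \<union> Y\<close>, so this is
  the case of a union up to complements.\<close>

lemma not_crossing_Diff:
  assumes "crossing V X Y" "\<not> crossing V X Z" "\<not> crossing V Y Z"
    and "X \<subseteq> V" "Y \<subseteq> V" "Z \<subseteq> V"
  shows "\<not> crossing V (X - Y) Z"
  using assms unfolding crossing_def by blast

definition min_cut :: "'a set \<Rightarrow> ('a set \<Rightarrow> nat) \<Rightarrow> 'a set \<Rightarrow> 'a \<Rightarrow> 'a \<Rightarrow> bool" where
  "min_cut V d X x y \<longleftrightarrow> X \<subseteq> V \<and> x \<in> X \<and> y \<in> V - X \<and>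
     (\<forall>Z. Z \<subseteq> V \<and> x \<in> Z \<and> y \<notin> Z \<longrightarrow> d X \<le> d Z)"

locale symmetric_submodular =
  fixes V :: "'a set" and d :: "'a set \<Rightarrow> nat"
  assumes finite_V: "finite V"
    and symmetric: "X \<subseteq> V \<Longrightarrow> d (V - X) = d X"
    and submodular: "X \<subseteq> V \<Longrightarrow> Y \<subseteq> V \<Longrightarrow> d (X \<inter> Y) + d (X \<union> Y) \<le> d X + d Y"
begin

lemma posimodular:
  assumes "X \<subseteq> V" "Y \<subseteq> V"
  shows "d (X - Y) + d (Y - X) \<le> d X + d Y"
proof -
  have "X \<inter> (V - Y) = X - Y" "X \<union> (V - Y) = V - (Y - X)"
    using assms by auto
  moreover have "d (V - (Y - X)) = d (Y - X)"
    using assms by (intro symmetric) auto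
  ultimately show ?thesis
    using submodular[of X "V - Y"] symmetric[of Y] assms by simp
qed

lemma min_cut_Diff:
  assumes "min_cut V d X x y"
  shows "min_cut V d (V - X) y x"
  unfolding min_cut_def
proof (intro conjI allI impI)
  fix Z assume Z: "Z \<subseteq> V \<and> y \<in> Z \<and> x \<notin> Z"
  then have "d X \<le> d (V - Z)"
    using assms unfolding min_cut_def by blast
  then show "d (V - X) \<le> d Z"
    using Z assms by (simp add: symmetric min_cut_def)
qed (use assms in \<open>auto simp: min_cut_def\<close>)

text \<open>Both candidates still separate \<open>x\<close> from \<open>y\<close>, which lie outside
  \<open>Y\<close>. If \<open>u\<close> is in \<open>X\<close>, then \<open>X \<inter> Y\<close>
  separates \<open>u\<close> from \<open>v\<close>, so it is no cheaper than \<open>Y\<close>, and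
  submodularity bounds \<open>d (X \<union> Y)\<close> by \<open>d X\<close>. Otherwise
  \<open>Y - X\<close> separates them and posimodularity bounds \<open>d (X - Y)\<close>.\<close>

lemma uncross_min_cut:
  assumes X: "min_cut V d X x y" and Y: "min_cut V d Y u v" and "x \<notin> Y" "y \<notin> Y"
  shows "\<exists>X' \<in> {X \<union> Y, X - Y}. min_cut V d X' x y"
proof -
  have sub: "X \<subseteq> V" "Y \<subseteq> V"
    using X Y by (auto simp: min_cut_def)
  have Z: "d Y \<le> d Z" if "Z \<subseteq> Y" "u \<in> Z" for Z
    using that Y unfolding min_cut_def by blast
  have smaller: "min_cut V d X' x y" if "d X' \<le> d X" "X' \<in> {X \<union> Y, X - Y}" for X'
    using X that \<open>x \<notin> Y\<close> \<open>y \<notin> Y\<close> sub unfolding min_cut_def by (auto intro: order_trans)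
  show ?thesis
  proof (cases "u \<in> X")
    case True
    then have "d Y \<le> d (X \<inter> Y)"
      using Y by (intro Z) (auto simp: min_cut_def)
    then have "d (X \<union> Y) \<le> d X"
      using submodular[OF sub] by simp
    then show ?thesis
      using smaller by blast
  next
    case False
    then have "d Y \<le> d (Y - X)"
      using Y by (intro Z) (auto simp: min_cut_def)
    then have "d (X - Y) \<le> d X"
      using posimodular[OF sub] by simp
    then show ?thesis
      using smaller by blast
  qed
qed

text \<open>A minimum cut crossing as few members of \<open>\<F>\<close> as possible crosses none:
  uncrossing it with a crossed member removes that crossing and creates no new one.\<close>

lemma min_cut_avoiding_crossings:
  assumes \<F>: "finite \<F>" "\<And>Y Z. Y \<in> \<F> \<Longrightarrow> Z \<in> \<F> \<Longrightarrow> \<not> crossing V Y Z"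
      "\<And>Y. Y \<in> \<F> \<Longrightarrow> \<exists>u v. min_cut V d Y u v"
    and X: "min_cut V d X x y"
    and unsep: "\<And>Y. Y \<in> \<F> \<Longrightarrow> \<not> separates Y x y"
  shows "\<exists>X'. min_cut V d X' x y \<and> (\<forall>Y \<in> \<F>. \<not> crossing V X' Y)"
proof -
  define crossed where "crossed X = {Y \<in> \<F>. crossing V X Y}" for X
  obtain X where X: "min_cut V d X x y"
    and least: "\<And>X'. min_cut V d X' x y \<Longrightarrow> card (crossed X) \<le> card (crossed X')"
    using ex_has_least_nat[of "\<lambda>X. min_cut V d X x y", OF X, of "\<lambda>X. card (crossed X)"] by auto
  have False if Y: "Y \<in> \<F>" and cross: "crossing V X Y" for Y
  proof -
    have XV: "X \<subseteq> V" and xy: "x \<in> V" "y \<in> V"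
      using X by (auto simp: min_cut_def)
    have \<F>V: "Z \<subseteq> V" if "Z \<in> \<F>" for Z
      using \<F>(3)[OF that] by (auto simp: min_cut_def)
    \<comment> \<open>\<open>Y\<close> and its complement give the same cut; the side missing both
      \<open>x\<close> and \<open>y\<close> is the one that \<open>uncross_min_cut\<close>
      needs.\<close>
    obtain Y' where Y': "Y' = Y \<or> Y' = V - Y" "x \<notin> Y'" "y \<notin> Y'"
      using unsep[OF Y] xy by (auto simp: separates_def)
    have Y'V: "Y' \<subseteq> V"
      using Y' \<F>V[OF Y] by auto
    have cross_Y': "crossing V Z Y' \<longleftrightarrow> crossing V Z Y" if "Z \<subseteq> V" for Z
      using crossing_Diff[OF that \<F>V[OF Y]] Y' by blast
    obtain u v where "min_cut V d Y' u v"
      using Y'(1) \<F>(3)[OF Y] min_cut_Diff[of Y] by metis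
    from uncross_min_cut[OF X this Y'(2,3)]
    obtain X' where X': "X' \<in> {X \<union> Y', X - Y'}" "min_cut V d X' x y"
      by blast
    have X'V: "X' \<subseteq> V"
      using X' by (auto simp: min_cut_def)
    have "\<not> crossing V X' Y"
      using not_crossing_uncrossed_pair[OF X'(1)] cross_Y'[OF X'V] by simp
    moreover have "crossing V X Z" if Z: "Z \<in> \<F>" "crossing V X' Z" for Z
    proof (rule ccontr)
      assume no_XZ: "\<not> crossing V X Z"
      have no_YZ: "\<not> crossing V Y' Z"
        using \<F>(2)[OF Z(1) Y] cross_Y'[OF \<F>V[OF Z(1)]] by (simp add: crossing_commute)
      have XY: "crossing V X Y'"
        using cross cross_Y'[OF XV] by simp
      show False
        using X'(1) Z(2) not_crossing_Un[OF XY no_XZ no_YZ]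
          not_crossing_Diff[OF XY no_XZ no_YZ XV Y'V \<F>V[OF Z(1)]] by auto
    qed
    ultimately have "crossed X' \<subset> crossed X"
      using Y cross by (auto simp: crossed_def)
    then have "card (crossed X') < card (crossed X)"
      using \<F>(1) by (intro psubset_card_mono) (auto simp: crossed_def)
    then show False
      using least[OF X'(2)] by simp
  qed
  then show ?thesis
    using X by blast
qed

text \<open>
  Uncrossing needs every member of the family to be a minimum cut for some pair of vertices,
  so the family is taken maximal under this additional condition.
\<close>

lemma cross_free_family:
  "\<exists>\<F> \<subseteq> Pow V. (\<forall>X \<in> \<F>. d X < k) \<and> (\<forall>X \<in> \<F>. \<forall>Y \<in> \<F>. \<not> crossing V X Y) \<and>
    (\<forall>X \<subseteq> V. d X < k \<longrightarrow>
      (\<forall>x \<in> V. \<forall>y \<in> V. separates X x y \<longrightarrow> (\<exists>Y \<in> \<F>. separates Y x y)))"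
proof -
  define good where "good \<F> \<longleftrightarrow> \<F> \<subseteq> Pow V \<and> (\<forall>X \<in> \<F>. d X < k \<and> (\<exists>x y. min_cut V d X x y)) \<and>
    (\<forall>X \<in> \<F>. \<forall>Y \<in> \<F>. \<not> crossing V X Y)" for \<F>
  have "finite {\<F>. good \<F>}"
    by (rule finite_subset[of _ "Pow (Pow V)"]) (auto simp: good_def finite_V)
  moreover have "{} \<in> {\<F>. good \<F>}"
    by (simp add: good_def)
  ultimately obtain \<F> where \<F>: "good \<F>" and maximal: "\<And>\<F>'. good \<F>' \<Longrightarrow> \<F> \<subseteq> \<F>' \<Longrightarrow> \<F>' = \<F>"
    using finite_has_maximal2[of "{\<F>. good \<F>}" "{}"] by auto
  have finite_\<F>: "finite \<F>"
    using \<F> finite_V by (auto simp: good_def intro: finite_subset)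
  have sep: "\<exists>Y \<in> \<F>. separates Y x y"
    if "X \<subseteq> V" "d X < k" "x \<in> X" "y \<in> V - X" for X x y
  proof (rule ccontr)
    assume unsep: "\<not> (\<exists>Y \<in> \<F>. separates Y x y)"
    have "X \<subseteq> V \<and> x \<in> X \<and> y \<notin> X"
      using that by simp
    \<comment> \<open>A minimum cut between \<open>x\<close> and \<open>y\<close> has size less than
      \<open>k\<close> as well. Once freed of crossings it can be added to \<open>\<F>\<close>, so
      by maximality it already belongs to \<open>\<F>\<close>, although no member separates
      \<open>x\<close> and \<open>y\<close>.\<close>
    from ex_has_least_nat[of "\<lambda>Z. Z \<subseteq> V \<and> x \<in> Z \<and> y \<notin> Z", OF this, of d]
    obtain X0 where X0: "X0 \<subseteq> V \<and> x \<in> X0 \<and> y \<notin> X0"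
      and least: "\<And>Z. Z \<subseteq> V \<and> x \<in> Z \<and> y \<notin> Z \<Longrightarrow> d X0 \<le> d Z"
      by blast
    have "min_cut V d X0 x y"
      using X0 least that by (auto simp: min_cut_def)
    then have "\<exists>X'. min_cut V d X' x y \<and> (\<forall>Y \<in> \<F>. \<not> crossing V X' Y)"
    proof (rule min_cut_avoiding_crossings[OF finite_\<F>, rotated 2])
      show "\<not> crossing V Y Z" if "Y \<in> \<F>" "Z \<in> \<F>" for Y Z
        using \<F> that by (simp add: good_def)
      show "\<exists>u v. min_cut V d Y u v" if "Y \<in> \<F>" for Y
        using \<F> that by (simp add: good_def)
      show "\<not> separates Y x y" if "Y \<in> \<F>" for Y
        using unsep that by simp
    qed
    then obtain X' where X': "min_cut V d X' x y" "\<And>Y. Y \<in> \<F> \<Longrightarrow> \<not> crossing V X' Y"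
      by auto
    have "d X' \<le> d X"
      using X'(1) that by (simp add: min_cut_def)
    then have "X' \<subseteq> V \<and> d X' < k \<and> (\<exists>x y. min_cut V d X' x y)"
      using X'(1) that(2) by (metis le_less_trans min_cut_def)
    moreover have "\<not> crossing V X' X'"
      by (simp add: crossing_def)
    moreover have "\<And>Y. Y \<in> \<F> \<Longrightarrow> \<not> crossing V Y X'"
      using X'(2) crossing_commute by metis
    ultimately have "good (insert X' \<F>)"
      using \<F> X'(2) by (simp add: good_def)
    then have "X' \<in> \<F>"
      using maximal by blast
    then show False
      using unsep X'(1) by (auto simp: separates_def min_cut_def)
  qed
  show ?thesis
  proof (intro exI[of _ \<F>] conjI allI ballI impI)
    fix X x y assume "X \<subseteq> V" "d X < k" "x \<in> V" "y \<in> V" "separates X x y"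
    then show "\<exists>Y \<in> \<F>. separates Y x y"
      using sep[of X x y] sep[of X y x] by (auto simp: separates_def)
  qed (use \<F> in \<open>auto simp: good_def\<close>)
qed

end

subsection \<open>Menger's theorem with several sinks\<close>

text \<open>An arc \<open>(e, u, v)\<close> is the edge \<open>e\<close> directed from \<open>u\<close> to \<open>v\<close>.\<close>

definition in_arcs :: "('e \<times> 'v \<times> 'v) set \<Rightarrow> 'v set \<Rightarrow> ('e \<times> 'v \<times> 'v) set" where
  "in_arcs A X = {(e, u, v) \<in> A. u \<notin> X \<and> v \<in> X}"

definition arc_rel :: "('e \<times> 'v \<times> 'v) set \<Rightarrow> ('v \<times> 'v) set" where
  "arc_rel A = {(u, v). \<exists>e. (e, u, v) \<in> A}"

text \<open>The cut condition for arc-disjoint connections from the source \<open>s\<close>, with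
  \<open>c v\<close> of them ending in each \<open>v\<close>.\<close>

definition meets_demand :: "'v \<Rightarrow> ('e \<times> 'v \<times> 'v) set \<Rightarrow> ('v \<Rightarrow> nat) \<Rightarrow> bool" where
  "meets_demand s A c \<longleftrightarrow> (\<forall>X. finite X \<and> s \<notin> X \<longrightarrow> sum c X \<le> card (in_arcs A X))"

definition tight :: "('e \<times> 'v \<times> 'v) set \<Rightarrow> ('v \<Rightarrow> nat) \<Rightarrow> 'v set \<Rightarrow> bool" where
  "tight A c X \<longleftrightarrow> sum c X = card (in_arcs A X)"

lemma finite_in_arcs: "finite A \<Longrightarrow> finite (in_arcs A X)"
  by (auto simp: in_arcs_def intro: finite_subset[of _ A])

lemma in_arcs_empty [simp]: "in_arcs A {} = {}"
  by (auto simp: in_arcs_def)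

lemma meets_demandD: "meets_demand s A c \<Longrightarrow> finite X \<Longrightarrow> s \<notin> X \<Longrightarrow> sum c X \<le> card (in_arcs A X)"
  by (auto simp: meets_demand_def)

text \<open>An arc entering one of \<open>X \<inter> Y\<close> and \<open>X \<union> Y\<close>
  enters \<open>X\<close> or \<open>Y\<close>; an arc entering both of the former enters both of the
  latter.\<close>

lemma in_arcs_submodular:
  assumes "finite A"
  shows "card (in_arcs A (X \<inter> Y)) + card (in_arcs A (X \<union> Y)) \<le> card (in_arcs A X) + card (in_arcs A Y)"
proof -
  let ?I = "in_arcs A"
  have fin: "finite (?I Z)" for Z
    using assms by (rule finite_in_arcs)
  have "card (?I (X \<inter> Y)) + card (?I (X \<union> Y)) =
      card (?I (X \<inter> Y) \<union> ?I (X \<union> Y)) + card (?I (X \<inter> Y) \<inter> ?I (X \<union> Y))"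
    by (intro card_Un_Int fin)
  also have "\<dots> \<le> card (?I X \<union> ?I Y) + card (?I X \<inter> ?I Y)"
    by (intro add_mono card_mono) (auto simp: fin, auto simp: in_arcs_def)
  also have "\<dots> = card (?I X) + card (?I Y)"
    by (intro card_Un_Int[symmetric] fin)
  finally show ?thesis .
qed

text \<open>Demand is modular and the number of entering arcs is submodular, so the cut conditions
  for intersection and union must both be equalities.\<close>

lemma tight_Un:
  assumes "finite A" "meets_demand s A c"
    and "finite X" "finite Y" "s \<notin> X" "s \<notin> Y" "tight A c X" "tight A c Y"
  shows "tight A c (X \<union> Y)"
proof -
  have "sum c (X \<inter> Y) \<le> card (in_arcs A (X \<inter> Y))" "sum c (X \<union> Y) \<le> card (in_arcs A (X \<union> Y))"
    using assms by (auto intro!: meets_demandD)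
  moreover have "sum c (X \<union> Y) + sum c (X \<inter> Y) = sum c X + sum c Y"
    using assms by (intro sum.union_inter) auto
  ultimately show ?thesis
    using in_arcs_submodular[OF \<open>finite A\<close>, of X Y] assms unfolding tight_def by linarith
qed

text \<open>Otherwise every in-neighbour of \<open>v\<close> lies in a tight set avoiding
  \<open>s\<close> and \<open>v\<close>. The union \<open>T\<close> of these sets is tight, and
  adding \<open>v\<close> to it admits no new entering arc but raises the demand by
  \<open>c v > 0\<close>.\<close>

lemma arc_avoiding_tight_sets:
  assumes A: "finite A" "meets_demand s A c" and v: "v \<noteq> s" "c v > 0"
  shows "\<exists>e u. (e, u, v) \<in> A \<and> u \<noteq> v \<and>
    (\<forall>X. finite X \<and> s \<notin> X \<and> u \<in> X \<and> v \<notin> X \<longrightarrow> \<not> tight A c X)"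
proof (rule ccontr)
  assume contra: "\<not> ?thesis"
  have hit: "\<exists>X. finite X \<and> s \<notin> X \<and> v \<notin> X \<and> tight A c X \<and> u \<in> X"
    if "(e, u, v) \<in> A" "u \<noteq> v" for e u
    using contra that by blast
  define N where "N = {u. (\<exists>e. (e, u, v) \<in> A) \<and> u \<noteq> v}"
  have "N \<subseteq> (fst \<circ> snd) ` A"
    by (force simp: N_def)
  then have "finite N"
    using A(1) by (auto intro: finite_subset)
  have cover: "\<exists>X. finite X \<and> s \<notin> X \<and> v \<notin> X \<and> tight A c X \<and> u \<in> X" if "u \<in> N" for u
    using that hit by (auto simp: N_def)
  have "\<exists>T. finite T \<and> s \<notin> T \<and> v \<notin> T \<and> tight A c T \<and> N' \<subseteq> T" if "N' \<subseteq> N" for N'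
    using finite_subset[OF that \<open>finite N\<close>] that
  proof (induction N' rule: finite_induct)
    case empty
    then show ?case
      by (intro exI[of _ "{}"]) (simp add: tight_def)
  next
    case (insert u N')
    then obtain T where T: "finite T" "s \<notin> T" "v \<notin> T" "tight A c T" "N' \<subseteq> T"
      by blast
    obtain X where X: "finite X" "s \<notin> X" "v \<notin> X" "tight A c X" "u \<in> X"
      using cover insert.prems by blast
    show ?case
      using T X tight_Un[OF A X(1) T(1) X(2) T(2) X(4) T(4)] by (intro exI[of _ "X \<union> T"]) auto
  qed
  from this[OF order_refl] obtain T where T: "finite T" "s \<notin> T" "v \<notin> T" "tight A c T" "N \<subseteq> T"
    by blast
  have "in_arcs A (insert v T) \<subseteq> in_arcs A T"
    using T(5) by (auto simp: in_arcs_def N_def)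
  then have "card (in_arcs A (insert v T)) \<le> sum c T"
    using T(4) A(1) by (simp add: tight_def card_mono finite_in_arcs)
  moreover have "sum c (insert v T) \<le> card (in_arcs A (insert v T))"
    using T v by (intro meets_demandD[OF A(2)]) auto
  ultimately show False
    using T v by simp
qed

text \<open>Only sets containing \<open>v\<close> but not \<open>u\<close> lose an entering arc, and
  their demand drops by one too. Only sets containing \<open>u\<close> but not \<open>v\<close> gain
  demand, and these have slack because they are not tight.\<close>

lemma meets_demand_shift:
  assumes A: "finite A" "meets_demand s A c" and a: "(e, u, v) \<in> A" "u \<noteq> v" and v: "c v > 0"
    and avoid: "\<And>X. finite X \<Longrightarrow> s \<notin> X \<Longrightarrow> u \<in> X \<Longrightarrow> v \<notin> X \<Longrightarrow> \<not> tight A c X"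
  shows "meets_demand s (A - {(e, u, v)}) (c(v := c v - 1, u := Suc (c u)))"
  unfolding meets_demand_def
proof (intro allI impI, elim conjE)
  fix X assume X: "finite X" "s \<notin> X"
  let ?a = "(e, u, v)"
  define c' where "c' = c(v := c v - 1, u := Suc (c u))"
  have le: "sum c X \<le> card (in_arcs A X)"
    using meets_demandD[OF A(2) X] .
  \<comment> \<open>The change of demand may be negative, hence the integers.\<close>
  have sum: "int (sum c' X) = int (sum c X) + of_bool (u \<in> X) - of_bool (v \<in> X)"
  proof -
    have "int (c' x) = int (c x) + (if x = u then 1 else 0) - (if x = v then 1 else 0)" for x
      using a(2) v by (auto simp: c'_def)
    then have "(\<Sum>x\<in>X. int (c' x)) =
        (\<Sum>x\<in>X. int (c x) + (if x = u then 1 else 0) - (if x = v then 1 else 0))"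
      by (rule sum.cong[OF refl])
    then show ?thesis
      using X by (simp add: sum.distrib sum_subtractf)
  qed
  have "sum c' X \<le> card (in_arcs (A - {?a}) X)"
  proof (cases "v \<in> X \<and> u \<notin> X")
    case True
    then have "in_arcs (A - {?a}) X = in_arcs A X - {?a}" "?a \<in> in_arcs A X"
      using a by (auto simp: in_arcs_def)
    then have "card (in_arcs A X) = Suc (card (in_arcs (A - {?a}) X))"
      using card_Suc_Diff1[OF finite_in_arcs[OF A(1)]] by metis
    then show ?thesis
      using sum le True by (simp del: of_nat_sum)
  next
    case False
    then have "in_arcs (A - {?a}) X = in_arcs A X"
      by (auto simp: in_arcs_def)
    moreover have "sum c X \<noteq> card (in_arcs A X)" if "u \<in> X" "v \<notin> X"
      using avoid[OF X that] by (simp add: tight_def)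
    ultimately show ?thesis
      using sum le False by (cases "u \<in> X"; cases "v \<in> X") (auto simp del: of_nat_sum)
  qed
  then show "sum (c(v := c v - 1, u := Suc (c u))) X \<le> card (in_arcs (A - {?a}) X)"
    by (simp only: c'_def)
qed

text \<open>
  Induction on the arcs: the last arc \<open>(e, u, v)\<close> of a
  path to \<open>v\<close> is deleted and one unit of the demand at \<open>v\<close> is moved to \<open>u\<close>.
\<close>

lemma disjoint_arc_connections:
  assumes "finite A" "meets_demand s A c"
  shows "\<exists>Q. (\<forall>v j. j < c v \<longrightarrow> Q (v, j) \<subseteq> A \<and> (s, v) \<in> (arc_rel (Q (v, j)))\<^sup>*) \<and>
    disjoint_family_on Q {(v, j). j < c v}"
  using assms
proof (induction A arbitrary: c rule: finite_psubset_induct)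
  case (psubset A)
  show ?case
  proof (cases "\<exists>v. v \<noteq> s \<and> c v > 0")
    case False
    \<comment> \<open>Demand is left only at the source, which the empty arc set connects to
      itself.\<close>
    then have "v = s" if "j < c v" for v j
      using that by fastforce
    then show ?thesis
      by (intro exI[of _ "\<lambda>_. {}"]) (auto simp: disjoint_family_on_def)
  next
    case True
    then obtain v where v: "v \<noteq> s" "c v > 0"
      by blast
    from arc_avoiding_tight_sets[OF psubset.hyps psubset.prems v]
    obtain e u where a: "(e, u, v) \<in> A" "u \<noteq> v"
      and avoid: "\<And>X. finite X \<Longrightarrow> s \<notin> X \<Longrightarrow> u \<in> X \<Longrightarrow> v \<notin> X \<Longrightarrow> \<not> tight A c X"
      by blast
    let ?a = "(e, u, v)"
    define c' where "c' = c(v := c v - 1, u := Suc (c u))"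
    have sub: "A - {?a} \<subset> A"
      using a by blast
    have "meets_demand s (A - {?a}) c'"
      unfolding c'_def using meets_demand_shift[OF psubset.hyps psubset.prems a v(2) avoid] .
    from psubset.IH[OF sub this] obtain Q where
      Q: "\<And>x j. j < c' x \<Longrightarrow> Q (x, j) \<subseteq> A - {?a} \<and> (s, x) \<in> (arc_rel (Q (x, j)))\<^sup>*"
      and disj: "disjoint_family_on Q {(x, j). j < c' x}"
      by blast
    \<comment> \<open>The unit moved to \<open>u\<close> received the index \<open>c u\<close>
      there. Its connection, prolonged by the deleted arc, becomes the last one for
      \<open>v\<close>; all other connections keep their indices.\<close>
    define Q' where "Q' = Q((v, c v - 1) := insert ?a (Q (u, c u)))"
    have c': "c' u = Suc (c u)" "c' v = c v - 1"
      using a(2) by (auto simp: c'_def)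
    have old: "j < c' x" "(x, j) \<noteq> (u, c u)" if "j < c x" "(x, j) \<noteq> (v, c v - 1)" for x j
      using that by (auto simp: c'_def split: if_splits)
    have "Q' (x, j) \<subseteq> A \<and> (s, x) \<in> (arc_rel (Q' (x, j)))\<^sup>*" if "j < c x" for x j
    proof (cases "(x, j) = (v, c v - 1)")
      case True
      have "(s, u) \<in> (arc_rel (Q (u, c u)))\<^sup>*"
        using Q[of "c u" u] c' by simp
      then have "(s, u) \<in> (arc_rel (insert ?a (Q (u, c u))))\<^sup>*"
        by (rule set_mp[OF rtrancl_mono, rotated]) (auto simp: arc_rel_def)
      moreover have "(u, v) \<in> arc_rel (insert ?a (Q (u, c u)))"
        by (auto simp: arc_rel_def)
      ultimately have "(s, v) \<in> (arc_rel (insert ?a (Q (u, c u))))\<^sup>*"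
        by (rule rtrancl_into_rtrancl)
      then show ?thesis
        using True a Q[of "c u" u] c' by (auto simp: Q'_def)
    next
      case False
      then show ?thesis
        using Q[OF old(1)[OF that False]] by (auto simp: Q'_def)
    qed
    moreover have "disjoint_family_on Q' {(x, j). j < c x}"
    proof (unfold disjoint_family_on_def, intro ballI impI)
      note dQ = disjoint_family_onD[OF disj]
      have new: "Q' (v, c v - 1) \<inter> Q' q = {}"
        if q': "q \<in> {(x, j). j < c x}" "q \<noteq> (v, c v - 1)" for q
      proof -
        have q: "q \<in> {(x, j). j < c' x}" "q \<noteq> (u, c u)"
          using old q' by (cases q; simp)+
        then have "?a \<notin> Q q"
          using Q[of "snd q" "fst q"] by (auto simp: case_prod_beta)
        moreover have "Q (u, c u) \<inter> Q q = {}"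
          using q c' by (intro dQ) auto
        ultimately show ?thesis
          using that by (auto simp: Q'_def)
      qed
      fix p q assume pq: "p \<in> {(x, j). j < c x}" "q \<in> {(x, j). j < c x}" "p \<noteq> q"
      consider "p = (v, c v - 1)" | "q = (v, c v - 1)" | "p \<noteq> (v, c v - 1)" "q \<noteq> (v, c v - 1)"
        by blast
      then show "Q' p \<inter> Q' q = {}"
      proof cases
        case 1
        then show ?thesis using new pq by metis
      next
        case 2
        then show ?thesis using new pq by (metis Int_commute)
      next
        case 3
        then have "Q p \<inter> Q q = {}"
          using old pq by (intro dQ) auto
        then show ?thesis
          using 3 by (simp add: Q'_def)
      qed
    qed
    ultimately show ?thesis
      by blast
  qed
qed

section \<open>Orienting the edges of an undirected graph\<close>

definition symmetric_arcs :: "('v, 'e) multigraph \<Rightarrow> ('e \<times> 'v \<times> 'v) set" where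
  "symmetric_arcs G = {(e, u, v). e \<in> edges G \<and> ends G e = {u, v} \<and> u \<noteq> v}"

text \<open>Deleting one arc costs a set at most one entering arc. A set violated by the deletion is
  therefore entered by that arc and had no slack before.\<close>

lemma tight_set_of_indispensable_arc:
  assumes A: "finite A" "meets_demand s A c" and a: "\<not> meets_demand s (A - {(e, u, v)}) c"
  obtains X where "finite X" "s \<notin> X" "u \<notin> X" "v \<in> X" "tight A c X"
proof -
  let ?a = "(e, u, v)"
  obtain X where X: "finite X" "s \<notin> X" "sum c X > card (in_arcs (A - {?a}) X)"
    using a by (auto simp: meets_demand_def not_le)
  have le: "sum c X \<le> card (in_arcs A X)"
    using meets_demandD[OF A(2) X(1,2)] .
  have eq: "in_arcs (A - {?a}) X = in_arcs A X - {?a}"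
    by (auto simp: in_arcs_def)
  have "?a \<in> in_arcs A X"
    using X(3) le eq by (metis Diff_insert0 Diff_empty not_le)
  moreover from this have "card (in_arcs A X) = Suc (card (in_arcs (A - {?a}) X))"
    using card_Suc_Diff1[OF finite_in_arcs[OF A(1)]] eq by metis
  ultimately show ?thesis
    using that X le by (auto simp: in_arcs_def tight_def)
qed

text \<open>
  In a minimal set of arcs meeting the demand no edge occurs in both directions: the two tight
  sets showing that both arcs are indispensable would violate submodularity.
\<close>

lemma antisymmetric_arcs_meeting_demand:
  assumes "finite B" "meets_demand s B c"
  shows "\<exists>A \<subseteq> B. meets_demand s A c \<and> (\<forall>e u v. (e, u, v) \<in> A \<and> u \<noteq> v \<longrightarrow> (e, v, u) \<notin> A)"
proof -
  have "finite {A. A \<subseteq> B \<and> meets_demand s A c}" "B \<in> {A. A \<subseteq> B \<and> meets_demand s A c}"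
    using assms by auto
  then obtain A where A: "A \<subseteq> B" "meets_demand s A c"
    and minimal: "\<And>A'. A' \<subseteq> B \<Longrightarrow> meets_demand s A' c \<Longrightarrow> A' \<subseteq> A \<Longrightarrow> A' = A"
    using finite_has_minimal2[of "{A. A \<subseteq> B \<and> meets_demand s A c}" B] by (smt (verit) mem_Collect_eq)
  have finA: "finite A"
    using A(1) assms(1) by (rule finite_subset)
  have indispensable: "\<not> meets_demand s (A - {a}) c" if "a \<in> A" for a
    using minimal[of "A - {a}"] A(1) that by blast
  have False if uv: "(e, u, v) \<in> A" "u \<noteq> v" "(e, v, u) \<in> A" for e u v
  proof -
    let ?a = "(e, u, v)" and ?b = "(e, v, u)"
    obtain X where X: "finite X" "s \<notin> X" "u \<notin> X" "v \<in> X" "tight A c X"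
      using tight_set_of_indispensable_arc[OF finA A(2) indispensable[OF uv(1)]] .
    obtain Y where Y: "finite Y" "s \<notin> Y" "v \<notin> Y" "u \<in> Y" "tight A c Y"
      using tight_set_of_indispensable_arc[OF finA A(2) indispensable[OF uv(3)]] .
    \<comment> \<open>Without the two opposite arcs, \<open>X\<close> and \<open>Y\<close> lose one
      entering arc each. \<open>X \<inter> Y\<close> contains neither end and
      \<open>X \<union> Y\<close> both, so these lose none, and submodularity fails by two.\<close>
    let ?A = "A - {?a, ?b}"
    have "in_arcs ?A X = in_arcs A X - {?a}" "?a \<in> in_arcs A X"
      "in_arcs ?A Y = in_arcs A Y - {?b}" "?b \<in> in_arcs A Y"
      using uv X Y by (auto simp: in_arcs_def)
    then have "card (in_arcs A X) = Suc (card (in_arcs ?A X))"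
      "card (in_arcs A Y) = Suc (card (in_arcs ?A Y))"
      using card_Suc_Diff1[OF finite_in_arcs[OF finA]] by metis+
    moreover have "card (in_arcs ?A (X \<inter> Y)) = card (in_arcs A (X \<inter> Y))"
      "card (in_arcs ?A (X \<union> Y)) = card (in_arcs A (X \<union> Y))"
      using X Y by (auto simp: in_arcs_def intro!: arg_cong[of _ _ card])
    moreover have "card (in_arcs ?A (X \<inter> Y)) + card (in_arcs ?A (X \<union> Y)) \<le>
        card (in_arcs ?A X) + card (in_arcs ?A Y)"
      using finA by (intro in_arcs_submodular) auto
    moreover have "sum c (X \<inter> Y) \<le> card (in_arcs A (X \<inter> Y))"
      "sum c (X \<union> Y) \<le> card (in_arcs A (X \<union> Y))"
      using X Y by (auto intro!: meets_demandD[OF A(2)])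
    moreover have "sum c (X \<union> Y) + sum c (X \<inter> Y) = sum c X + sum c Y"
      using X Y by (intro sum.union_inter) auto
    ultimately show False
      using X(5) Y(5) unfolding tight_def by linarith
  qed
  then show ?thesis
    using A by blast
qed

subsection \<open>Immersions of complete graphs\<close>

text \<open>Connections are handled as edge sets together with reachability; actual paths are
  extracted only in \<open>path_of_link_rel\<close>.\<close>

definition link_rel :: "('v, 'e) multigraph \<Rightarrow> 'e set \<Rightarrow> ('v \<times> 'v) set" where
  "link_rel G D = {(u, v). \<exists>e \<in> D. ends G e = {u, v}}"

lemma sym_link_rel: "sym (link_rel G D)"
  by (auto simp: sym_def link_rel_def insert_commute)

lemma link_rel_mono: "D \<subseteq> D' \<Longrightarrow> (u, v) \<in> (link_rel G D)\<^sup>* \<Longrightarrow> (u, v) \<in> (link_rel G D')\<^sup>*"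
  by (rule set_mp[OF rtrancl_mono]) (auto simp: link_rel_def)

section \<open>Edge-cuts, edge-disjoint connections and branch vertices in a multigraph\<close>

context finite_multigraph
begin

text \<open>An edge has at most two ends, so meeting both sides determines it as a cut edge. In this
  form complements, unions and intersections of sides become plain set computations.\<close>

lemma cut_edges_eq:
  assumes "X \<subseteq> verts G"
  shows "cut_edges G X = {e \<in> edges G. ends G e \<inter> X \<noteq> {} \<and> ends G e - X \<noteq> {}}"
proof -
  have "\<exists>x \<in> X. \<exists>y \<in> verts G - X. ends G e = {x, y}"
    if e: "e \<in> edges G" and xy: "x \<in> ends G e" "x \<in> X" "y \<in> ends G e" "y \<notin> X" for e x y
  proof -
    have "card {x, y} = 2"
      using xy by (metis card_2_iff)
    moreover have "finite (ends G e)" "{x, y} \<subseteq> ends G e"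
      using card_ends[OF e] xy by (auto intro: card_ge_0_finite)
    ultimately have "ends G e = {x, y}"
      using card_ends[OF e] card_mono[of "ends G e" "{x, y}"]
      by (intro card_subset_eq[symmetric]) auto
    then show ?thesis
      using xy ends_subset[OF e] by blast
  qed
  then show ?thesis
    using assms by (auto simp: cut_edges_def)
qed

lemma finite_cut_edges: "finite (cut_edges G X)"
  using finite_edges by (auto simp: cut_edges_def)

lemma symmetric_submodular_cut_edges:
  "symmetric_submodular (verts G) (\<lambda>X. card (cut_edges G X))"
proof
  show "finite (verts G)"
    by (rule finite_verts)
next
  fix X assume X: "X \<subseteq> verts G"
  have "cut_edges G (verts G - X) = cut_edges G X"
    unfolding cut_edges_eq[OF X] cut_edges_eq[OF Diff_subset] using ends_subset by blast
  then show "card (cut_edges G (verts G - X)) = card (cut_edges G X)"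
    by simp
next
  fix X Y assume X: "X \<subseteq> verts G" and Y: "Y \<subseteq> verts G"
  let ?C = "cut_edges G"
  have XY: "X \<inter> Y \<subseteq> verts G" "X \<union> Y \<subseteq> verts G"
    using X Y by auto
  have "card (?C (X \<inter> Y)) + card (?C (X \<union> Y)) =
      card (?C (X \<inter> Y) \<union> ?C (X \<union> Y)) + card (?C (X \<inter> Y) \<inter> ?C (X \<union> Y))"
    by (intro card_Un_Int finite_cut_edges)
  also have "\<dots> \<le> card (?C X \<union> ?C Y) + card (?C X \<inter> ?C Y)"
    unfolding cut_edges_eq[OF X] cut_edges_eq[OF Y] cut_edges_eq[OF XY(1)] cut_edges_eq[OF XY(2)]
    using finite_edges by (intro add_mono card_mono) auto
  also have "\<dots> = card (?C X) + card (?C Y)"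
    by (intro card_Un_Int[symmetric] finite_cut_edges)
  finally show "card (?C (X \<inter> Y)) + card (?C (X \<union> Y)) \<le> card (?C X) + card (?C Y)" .
qed

lemma finite_symmetric_arcs: "finite (symmetric_arcs G)"
proof (rule finite_subset)
  show "symmetric_arcs G \<subseteq> edges G \<times> verts G \<times> verts G"
    using ends_subset by (fastforce simp: symmetric_arcs_def)
qed (use finite_edges finite_verts in auto)

text \<open>One of the two directions of every cut edge enters \<open>X\<close>. Demand conditions
  concern arbitrary finite sets, hence the intersection with \<open>verts G\<close>.\<close>

lemma card_cut_edges_le_in_arcs:
  "card (cut_edges G (X \<inter> verts G)) \<le> card (in_arcs (symmetric_arcs G) X)"
proof (rule surj_card_le)
  show "finite (in_arcs (symmetric_arcs G) X)"
    by (intro finite_in_arcs finite_symmetric_arcs)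
  show "cut_edges G (X \<inter> verts G) \<subseteq> fst ` in_arcs (symmetric_arcs G) X"
  proof
    fix e assume "e \<in> cut_edges G (X \<inter> verts G)"
    then obtain x y where "e \<in> edges G" "x \<in> X" "y \<notin> X" "ends G e = {y, x}"
      by (auto simp: cut_edges_def)
    then have "(e, y, x) \<in> in_arcs (symmetric_arcs G) X"
      by (auto simp: in_arcs_def symmetric_arcs_def)
    then show "e \<in> fst ` in_arcs (symmetric_arcs G) X"
      by force
  qed
qed

lemma path_of_link_rel:
  assumes "(u, v) \<in> (link_rel G D)\<^sup>*" "D \<subseteq> edges G" "u \<in> verts G"
  shows "\<exists>w p. is_path G w p \<and> hd w = u \<and> last w = v \<and> set p \<subseteq> D"
  using assms(1)
proof (induction rule: rtrancl_induct)
  case base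
  then show ?case
    using assms(3) by (intro exI[of _ "[u]"] exI[of _ "[]"]) (auto simp: is_path_def)
next
  case (step y z)
  then obtain w p where w: "is_path G w p" "hd w = u" "last w = y" "set p \<subseteq> D"
    by blast
  obtain e where e: "e \<in> D" "ends G e = {y, z}"
    using step.hyps by (auto simp: link_rel_def)
  have len: "length w = Suc (length p)" "w \<noteq> []"
    using w(1) by (auto simp: is_path_def)
  show ?case
  proof (cases "z \<in> set w")
    \<comment> \<open>The walk returns to a vertex of the path built so far, which is cut back to
      that vertex.\<close>
    case True
    then obtain i where i: "i < length w" "w ! i = z"
      by (auto simp: in_set_conv_nth)
    have "is_path G (take (Suc i) w) (take i p)"
      using w(1) i len set_take_subset[of i p] set_take_subset[of "Suc i" w]
      by (auto simp: is_path_def)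
    moreover have "hd (take (Suc i) w) = u"
      using w(2) by simp
    moreover have "last (take (Suc i) w) = z"
      using i by (simp add: take_Suc_conv_app_nth)
    moreover have "set (take i p) \<subseteq> D"
      using w(4) set_take_subset[of i p] by blast
    ultimately show ?thesis
      by blast
  next
    case False
    have "z \<in> verts G"
      using e assms(2) ends_subset[of e] by auto
    moreover have "w ! length p = y"
      using w(3) len by (simp add: last_conv_nth)
    ultimately have "is_path G (w @ [z]) (p @ [e])"
      using w(1) e len False assms(2)
      by (auto simp: is_path_def nth_append less_Suc_eq)
    then show ?thesis
      using w e len by (intro exI[of _ "w @ [z]"] exI[of _ "p @ [e]"]) auto
  qed
qed

text \<open>Disjoint edge sets connecting the branch vertices suffice, since a path can be chosen
  inside each of them.\<close>

lemma immersed_completeI: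
  assumes \<phi>: "inj_on \<phi> {..<t}" "\<phi> ` {..<t} \<subseteq> verts G"
    and D: "disjoint_family_on D (edges (complete_graph t))"
      "\<And>e. D e \<subseteq> edges G"
    and link: "\<And>i j. i < j \<Longrightarrow> j < t \<Longrightarrow> (\<phi> i, \<phi> j) \<in> (link_rel G (D {i, j}))\<^sup>*"
  shows "immersed (complete_graph t) G"
proof -
  have "\<exists>w p. is_path G w p \<and> {hd w, last w} = \<phi> ` e \<and> set p \<subseteq> D e"
    if e: "e \<in> edges (complete_graph t)" for e
  proof -
    have "e \<subseteq> {..<t}" "card e = 2"
      using e by (auto simp: complete_graph_def)
    then obtain a b where ab: "e = {a, b}" "a \<noteq> b" "a < t" "b < t"
      unfolding card_2_iff by auto
    define i j where "i = min a b" and "j = max a b"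
    have ij: "e = {i, j}" "i < j" "j < t"
      using ab by (auto simp: i_def j_def min_def max_def)
    have "\<phi> i \<in> verts G"
      using \<phi>(2) ij by auto
    from path_of_link_rel[OF link[OF ij(2,3)] D(2) this]
    obtain w p where "is_path G w p" "hd w = \<phi> i" "last w = \<phi> j" "set p \<subseteq> D e"
      unfolding ij(1) by blast
    then show ?thesis
      by (intro exI[of _ w] exI[of _ p]) (simp add: ij(1))
  qed
  then obtain W P where WP: "\<And>e. e \<in> edges (complete_graph t) \<Longrightarrow>
      is_path G (W e) (P e) \<and> {hd (W e), last (W e)} = \<phi> ` e \<and> set (P e) \<subseteq> D e"
    by metis
  have "disjoint_family_on (\<lambda>e. set (P e)) (edges (complete_graph t))"
    using D(1) WP unfolding disjoint_family_on_def by blast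
  moreover have "ends (complete_graph t) e = e" "verts (complete_graph t) = {..<t}" for e
    by (auto simp: complete_graph_def)
  ultimately show ?thesis
    unfolding immersed_def using \<phi> WP by (intro exI[of _ \<phi>] exI[of _ W] exI[of _ P]) auto
qed

text \<open>After passing to arcs that use each edge in one direction only, \<open>fst\<close> is
  injective on them, and arc-disjoint connections become edge-disjoint.\<close>

lemma disjoint_edge_connections:
  assumes "meets_demand s (symmetric_arcs G) c"
  shows "\<exists>F. (\<forall>v j. j < c v \<longrightarrow> F (v, j) \<subseteq> edges G \<and> (s, v) \<in> (link_rel G (F (v, j)))\<^sup>*) \<and>
    disjoint_family_on F {(v, j). j < c v}"
proof -
  obtain A where A: "A \<subseteq> symmetric_arcs G" "meets_demand s A c"
    and anti: "\<And>e u v. (e, u, v) \<in> A \<Longrightarrow> u \<noteq> v \<Longrightarrow> (e, v, u) \<notin> A"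
    using antisymmetric_arcs_meeting_demand[OF finite_symmetric_arcs assms] by auto
  from disjoint_arc_connections[OF finite_subset[OF A(1) finite_symmetric_arcs] A(2)]
  obtain Q where Q: "\<And>v j. j < c v \<Longrightarrow> Q (v, j) \<subseteq> A \<and> (s, v) \<in> (arc_rel (Q (v, j)))\<^sup>*"
    and disj: "disjoint_family_on Q {(v, j). j < c v}"
    by blast
  have inj: "inj_on fst A"
  proof (rule inj_onI)
    fix a b assume ab: "a \<in> A" "b \<in> A" "fst a = fst b"
    obtain e u v x y where eq: "a = (e, u, v)" "b = (e, x, y)"
      using ab(3) by (metis prod.collapse)
    have "{u, v} = {x, y}" "u \<noteq> v"
      using ab A(1) unfolding eq symmetric_arcs_def by auto
    then show "a = b"
      using anti[of e u v] ab unfolding eq by (auto simp: doubleton_eq_iff)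
  qed
  show ?thesis
  proof (intro exI[of _ "\<lambda>p. fst ` Q p"] conjI allI impI)
    fix v j assume j: "j < c v"
    have sub: "Q (v, j) \<subseteq> symmetric_arcs G"
      using Q[OF j] A(1) by blast
    then show "fst ` Q (v, j) \<subseteq> edges G"
      by (auto simp: symmetric_arcs_def)
    have "arc_rel (Q (v, j)) \<subseteq> link_rel G (fst ` Q (v, j))"
    proof (rule subrelI)
      fix x y assume "(x, y) \<in> arc_rel (Q (v, j))"
      then obtain e where e: "(e, x, y) \<in> Q (v, j)"
        by (auto simp: arc_rel_def)
      then have "e \<in> fst ` Q (v, j)" "ends G e = {x, y}"
        using sub by (auto simp: symmetric_arcs_def intro: rev_image_eqI)
      then show "(x, y) \<in> link_rel G (fst ` Q (v, j))"
        by (auto simp: link_rel_def)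
    qed
    then show "(s, v) \<in> (link_rel G (fst ` Q (v, j)))\<^sup>*"
      by (rule subsetD[OF rtrancl_mono]) (simp add: Q[OF j])
  next
    show "disjoint_family_on (\<lambda>p. fst ` Q p) {(v, j). j < c v}"
    proof (unfold disjoint_family_on_def, intro ballI impI)
      fix p q assume pq: "p \<in> {(v, j). j < c v}" "q \<in> {(v, j). j < c v}" "p \<noteq> q"
      then have "Q p \<inter> Q q = {}"
        by (rule disjoint_family_onD[OF disj])
      moreover have "Q p \<subseteq> A" "Q q \<subseteq> A"
        using pq(1,2) Q[of "snd p" "fst p"] Q[of "snd q" "fst q"] by (auto simp: case_prod_beta)
      ultimately show "fst ` Q p \<inter> fst ` Q q = {}"
        using inj_on_image_Int[OF inj, of "Q p" "Q q"] by simp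
    qed
  qed
qed

lemma highly_connected_imp_immersed:
  assumes \<phi>: "inj_on \<phi> {..<t}" "\<phi> ` {..<t} \<subseteq> verts G"
    and conn: "\<And>X i j. X \<subseteq> verts G \<Longrightarrow> i < t \<Longrightarrow> j < t \<Longrightarrow> separates X (\<phi> i) (\<phi> j) \<Longrightarrow>
      (t - 1)\<^sup>2 \<le> card (cut_edges G X)"
  shows "immersed (complete_graph t) G"
proof -
  \<comment> \<open>The sinks are all branch vertices except the source \<open>\<phi> 0\<close>.
    Each asks for \<open>t - 1\<close> connections, so no set demands more than
    \<open>(t - 1)\<^sup>2\<close>, the assumed lower bound for cuts.\<close>
  define S where "S = \<phi> ` {0<..<t}"
  define c where "c v = (if v \<in> S then t - 1 else 0)" for v
  have "card S \<le> t - 1"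
    using card_image_le[of "{0<..<t}" \<phi>] by (simp add: S_def)
  have "finite S"
    by (simp add: S_def)
  have demand: "meets_demand (\<phi> 0) (symmetric_arcs G) c"
    unfolding meets_demand_def
  proof (intro allI impI, elim conjE)
    fix X assume X: "finite X" "\<phi> 0 \<notin> X"
    have sum: "sum c X = card (X \<inter> S) * (t - 1)"
      using X by (simp add: c_def sum.If_cases Int_def)
    show "sum c X \<le> card (in_arcs (symmetric_arcs G) X)"
    proof (cases "X \<inter> S = {}")
      case True
      then show ?thesis
        using sum by simp
    next
      case False
      then obtain i where i: "0 < i" "i < t" "\<phi> i \<in> X"
        by (auto simp: S_def)
      have "card (X \<inter> S) \<le> t - 1"
        using card_mono[OF \<open>finite S\<close>, of "X \<inter> S"] \<open>card S \<le> t - 1\<close> by simp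
      then have "sum c X \<le> (t - 1)\<^sup>2"
        unfolding sum power2_eq_square by (rule mult_le_mono1)
      also have "\<dots> \<le> card (cut_edges G (X \<inter> verts G))"
        using i X \<phi>(2) by (intro conn[of _ 0 i]) (auto simp: separates_def)
      also have "\<dots> \<le> card (in_arcs (symmetric_arcs G) X)"
        by (rule card_cut_edges_le_in_arcs)
      finally show ?thesis .
    qed
  qed
  obtain F where F: "\<And>v j. j < c v \<Longrightarrow> F (v, j) \<subseteq> edges G"
    "\<And>v j. j < c v \<Longrightarrow> (\<phi> 0, v) \<in> (link_rel G (F (v, j)))\<^sup>*"
    and disj: "disjoint_family_on F {(v, j). j < c v}"
    using disjoint_edge_connections[OF demand] by auto
  \<comment> \<open>A pair \<open>(a, b)\<close> names the \<open>b\<close>-th connection to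
    \<open>\<phi> a\<close>. Diagonal pairs serve the edges at \<open>0\<close>; an edge
    \<open>{a, b}\<close> avoiding \<open>0\<close> receives both \<open>(a, b)\<close> and
    \<open>(b, a)\<close>.\<close>
  define I where "I e = {(a, b). a \<in> {0<..<t} \<and> b \<in> {0<..<t} \<and> (if a = b then {0, a} else {a, b}) = e}"
    for e :: "nat set"
  \<comment> \<open>The second components of pairs start at 1, the indices of \<open>F\<close> at
    0.\<close>
  define f where "f = (\<lambda>(a, b). (\<phi> a, b - 1 :: nat))"
  define D where "D e = (\<Union>p \<in> I e. F (f p))" for e
  have f: "f p \<in> {(v, j). j < c v}" if "p \<in> I e" for p e
    using that by (auto simp: I_def f_def c_def S_def)
  have link: "(\<phi> 0, \<phi> a) \<in> (link_rel G (D e))\<^sup>*" if "(a, b) \<in> I e" for a b e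
  proof (rule link_rel_mono)
    show "F (f (a, b)) \<subseteq> D e"
      using that by (auto simp: D_def)
    show "(\<phi> 0, \<phi> a) \<in> (link_rel G (F (f (a, b))))\<^sup>*"
      using F(2) f[OF that] by (auto simp: f_def)
  qed
  show ?thesis
  proof (rule immersed_completeI[OF \<phi>])
    show "D e \<subseteq> edges G" for e
      using F(1) f[of _ e] by (fastforce simp: D_def)
    show "disjoint_family_on D (edges (complete_graph t))"
    proof (unfold disjoint_family_on_def, intro ballI impI)
      fix e e' :: "nat set" assume "e \<noteq> e'"
      have "F (f p) \<inter> F (f q) = {}" if p: "p \<in> I e" and q: "q \<in> I e'" for p q
      proof -
        obtain a b x y where eq: "p = (a, b)" "q = (x, y)"
          and lt: "a < t" "x < t" "0 < b" "0 < y"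
          using p q by (auto simp: I_def)
        have "p \<noteq> q"
          using p q \<open>e \<noteq> e'\<close> by (auto simp: I_def)
        \<comment> \<open>Truncated subtraction does no harm, as \<open>b\<close> and
          \<open>y\<close> are positive.\<close>
        then have "f p \<noteq> f q"
          using lt inj_on_eq_iff[OF \<phi>(1), of a x] by (auto simp: eq f_def)
        then show ?thesis
          by (rule disjoint_family_onD[OF disj f[OF p] f[OF q]])
      qed
      then show "D e \<inter> D e' = {}"
        by (simp add: D_def Int_UN_distrib2)
    qed
    fix i j :: nat assume ij: "i < j" "j < t"
    show "(\<phi> i, \<phi> j) \<in> (link_rel G (D {i, j}))\<^sup>*"
    proof (cases "i = 0")
      case True
      then have "(j, j) \<in> I {i, j}"
        using ij by (auto simp: I_def)
      then show ?thesis
        using link True by simp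
    next
      case False
      then have "(i, j) \<in> I {i, j}" "(j, i) \<in> I {i, j}"
        using ij by (auto simp: I_def)
      then have "(\<phi> 0, \<phi> i) \<in> (link_rel G (D {i, j}))\<^sup>*" "(\<phi> 0, \<phi> j) \<in> (link_rel G (D {i, j}))\<^sup>*"
        by - (erule link)+
      \<comment> \<open>The two connections are joined at \<open>\<phi> 0\<close>, the first one
        being reversed.\<close>
      then show ?thesis
        by (metis symD[OF sym_rtrancl[OF sym_link_rel]] rtrancl_trans)
    qed
  qed
qed

end

section \<open>Laminarity and the size of the blocks\<close>

lemma uncrossed_if_not_crossing:
  assumes "\<not> crossing (verts G) X Y"
  shows "uncrossed G X Y"
  unfolding uncrossed_def
proof
  fix C assume "C \<in> components G"
  then have "C \<subseteq> verts G"
    by (auto simp: components_def)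
  \<comment> \<open>Each of the four empty corners is a containment between sides of the cuts, and
    it persists in every component.\<close>
  have "X \<inter> Y = {} \<or> X - Y = {} \<or> Y - X = {} \<or> verts G - (X \<union> Y) = {}"
    using assms unfolding crossing_def by argo
  then have "X \<inter> C \<subseteq> C - Y \<or> X \<inter> C \<subseteq> Y \<inter> C \<or> C - X \<subseteq> C - Y \<or> C - X \<subseteq> Y \<inter> C"
    using \<open>C \<subseteq> verts G\<close> by (elim disjE) auto
  then show "\<exists>A \<in> {X \<inter> C, C - X}. \<exists>B \<in> {Y \<inter> C, C - Y}. A \<subseteq> B"
    by auto
qed

theorem theorem1:
  fixes G :: "('v, 'e) multigraph" and t :: nat
  assumes "t \<ge> 1"
    and "finite_multigraph G"
    and "\<not> immersed (complete_graph t) G"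
  shows "\<exists>\<F>. \<F> \<subseteq> Pow (verts G) \<and> laminar G \<F> \<and>
           (\<forall>X \<in> \<F>. card (cut_edges G X) < (t - 1)\<^sup>2) \<and>
           (\<forall>B \<in> blocks G \<F>. card B < t)"
proof -
  interpret finite_multigraph G
    by fact
  interpret symmetric_submodular "verts G" "\<lambda>X. card (cut_edges G X)"
    by (rule symmetric_submodular_cut_edges)
  obtain \<F> where \<F>: "\<F> \<subseteq> Pow (verts G)" "\<forall>X \<in> \<F>. card (cut_edges G X) < (t - 1)\<^sup>2"
    "\<forall>X \<in> \<F>. \<forall>Y \<in> \<F>. \<not> crossing (verts G) X Y"
    and sep: "\<forall>X \<subseteq> verts G. card (cut_edges G X) < (t - 1)\<^sup>2 \<longrightarrow>
      (\<forall>x \<in> verts G. \<forall>y \<in> verts G. separates X x y \<longrightarrow> (\<exists>Y \<in> \<F>. separates Y x y))"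
    using cross_free_family[of "(t - 1)\<^sup>2"] by (elim exE conjE)
  have "card B < t" if B: "B \<in> blocks G \<F>" for B
  proof (rule ccontr)
    assume "\<not> card B < t"
    then obtain S where S: "S \<subseteq> B" "card S = t" "finite S"
      by (metis not_le obtain_subset_with_card_n)
    then obtain \<phi> where \<phi>: "bij_betw \<phi> {..<t} S"
      using ex_bij_betw_nat_finite[of S] by (auto simp: lessThan_atLeast0)
    obtain x where x: "x \<in> verts G" "B = unseparated G \<F> `` {x}"
      using B by (auto simp: blocks_def elim: quotientE)
    have BV: "B \<subseteq> verts G"
      unfolding x by (auto simp: unseparated_def)
    have unsep: "\<not> separates Y u v" if "u \<in> B" "v \<in> B" "Y \<in> \<F>" for Y u v
      using that unfolding x unseparated_def separates_def by auto
    have \<phi>B: "\<phi> i \<in> B" if "i < t" for i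
      using \<phi> S that by (auto simp: bij_betw_def)
    have "immersed (complete_graph t) G"
    proof (rule highly_connected_imp_immersed)
      show "inj_on \<phi> {..<t}"
        using \<phi> by (simp add: bij_betw_def)
      show "\<phi> ` {..<t} \<subseteq> verts G"
        using \<phi>B BV by auto
      \<comment> \<open>A smaller cut between two of the chosen vertices would make some member of
        \<open>\<F>\<close> separate them, but they share a block.\<close>
      show "(t - 1)\<^sup>2 \<le> card (cut_edges G X)"
        if ij: "X \<subseteq> verts G" "i < t" "j < t" "separates X (\<phi> i) (\<phi> j)" for X i j
      proof (rule ccontr)
        assume "\<not> ?thesis"
        moreover have "\<phi> i \<in> verts G" "\<phi> j \<in> verts G"
          using \<phi>B ij BV by auto
        ultimately obtain Y where "Y \<in> \<F>" "separates Y (\<phi> i) (\<phi> j)"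
          using sep ij(1,4) by (meson not_le)
        then show False
          using unsep[OF \<phi>B \<phi>B] ij(2,3) by simp
      qed
    qed
    then show False
      using assms(3) by simp
  qed
  moreover have "laminar G \<F>"
    using \<F>(3) by (auto simp: laminar_def intro: uncrossed_if_not_crossing)
  ultimately show ?thesis
    using \<F>(1,2) by blast
qed

end
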